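(* There exists a Markov matrix that is defective, i.e. not diagonalizable (not similar over $\mathbb{C}$ to a diagonal matrix).
   Context: A real $n\times n$ matrix $A=(a_{ij})$ is called a Markov matrix if $a_{ij}\ge 0$ for all $1\le i,j\le n$ and $\sum_{i=1}^n a_{ij}=1$ for every $1\le j\le n$ (each column sums to $1$). *)

theory Defs
  imports Complex_Main "Jordan_Normal_Form.Jordan_Normal_Form"
begin

definition markov_mat :: "nat \<Rightarrow> real mat \<Rightarrow> bool" where
  "markov_mat n A \<longleftrightarrow>
     A \<in> carrier_mat n n \<and>
     (\<forall>i<n. \<forall>j<n. A $$ (i, j) \<ge> 0) \<and>
     (\<forall>j<n. (\<Sum>i<n. A $$ (i, j)) = 1)"

definition diagonalizable_mat :: "'a::field mat \<Rightarrow> bool" where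
  "diagonalizable_mat A \<longleftrightarrow> (\<exists>D. diagonal_mat D \<and> similar_mat A D)"

definition defective_mat :: "real mat \<Rightarrow> bool" where
  "defective_mat A \<longleftrightarrow> square_mat A \<and> \<not> diagonalizable_mat (map_mat complex_of_real A)"

end

(* For A = [[1, 1/2, 0], [0, 1/2, 1/2], [0, 0, 1/2]] every complex eigenvector has last coordinate 0.
   Hence the eigenvectors do not span, and no invertible P satisfies A P = P D with D diagonal. *)
theory Submission
  imports Defs
begin

text \<open>The double eigenvalue 1/2 sits in the lower right block [[1/2, 1/2], [0, 1/2]], which is
  not diagonalizable. The first row only fills each column up to sum 1.\<close>

definition defective_markov :: "real mat" where
  "defective_markov = mat_of_rows_list 3 [[1, 1/2, 0], [0, 1/2, 1/2], [0, 0, 1/2]]"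

lemma defective_markov_carrier: "defective_markov \<in> carrier_mat 3 3"
  by (rule carrier_matI) (simp_all add: defective_markov_def mat_of_rows_list_def)

lemma markov_defective_markov: "markov_mat 3 defective_markov"
proof -
  have "defective_markov $$ (i, j) \<ge> 0" if "i < 3" "j < 3" for i j
    using that
    by (auto simp: defective_markov_def mat_of_rows_list_def numeral_3_eq_3 less_Suc_eq)
  moreover have "(\<Sum>i<3. defective_markov $$ (i, j)) = 1" if "j < 3" for j
    using that
    by (auto simp: defective_markov_def mat_of_rows_list_def numeral_3_eq_3 less_Suc_eq)
  ultimately show ?thesis
    by (simp add: markov_mat_def defective_markov_carrier)
qed

text \<open>Multiplying \<open>A = P * D * Q\<close> on the right by \<open>P\<close> and using
  \<open>Q * P = 1\<^sub>m n\<close> gives \<open>A * P = P * D\<close>. Since \<open>D\<close> is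
  diagonal, column \<open>j\<close> of this identity says that column \<open>j\<close> of
  \<open>P\<close> satisfies the eigenvector equation for \<open>D $$ (j, j)\<close>. The conclusion
  is stated by entries so that single rows of the equation can be read off.\<close>

lemma similar_diagonal_matE:
  fixes A :: "'a::field mat"
  assumes "A \<in> carrier_mat n n" and "similar_mat A D" and "diagonal_mat D"
  obtains P Q where "P \<in> carrier_mat n n" and "Q \<in> carrier_mat n n" and "P * Q = 1\<^sub>m n"
    and "\<And>i j. i < n \<Longrightarrow> j < n \<Longrightarrow> (\<Sum>k<n. A $$ (i, k) * P $$ (k, j)) = D $$ (j, j) * P $$ (i, j)"
proof -
  obtain P Q where "similar_mat_wit A D P Q"
    using assms(2) by (auto simp: similar_mat_def)
  from similar_mat_witD2[OF assms(1) this]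
  have PQ: "P * Q = 1\<^sub>m n" "Q * P = 1\<^sub>m n" and A: "A = P * D * Q"
    and carr: "D \<in> carrier_mat n n" "P \<in> carrier_mat n n" "Q \<in> carrier_mat n n"
    by auto
  have "A * P = P * D * (Q * P)"
    unfolding A using carr by (intro assoc_mult_mat) auto
  then have AP: "A * P = P * D"
    using PQ carr by simp
  have "(\<Sum>k<n. A $$ (i, k) * P $$ (k, j)) = D $$ (j, j) * P $$ (i, j)" if ij: "i < n" "j < n" for i j
  proof -
    have "(\<Sum>k<n. A $$ (i, k) * P $$ (k, j)) = (A * P) $$ (i, j)"
      using ij carr assms(1) by (simp add: scalar_prod_def atLeast0LessThan)
    also have "\<dots> = (\<Sum>k<n. P $$ (i, k) * D $$ (k, j))"
      unfolding AP using ij carr by (simp add: scalar_prod_def atLeast0LessThan)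
    also have "\<dots> = (\<Sum>k<n. if k = j then P $$ (i, j) * D $$ (j, j) else 0)"
      using ij carr assms(3) by (intro sum.cong) (auto simp: diagonal_mat_def)
    also have "\<dots> = D $$ (j, j) * P $$ (i, j)"
      using ij by simp
    finally show ?thesis .
  qed
  with carr(2,3) PQ(1) show thesis
    by (rule that)
qed

lemma defective_mat_defective_markov: "defective_mat defective_markov"
proof -
  let ?A = "map_mat complex_of_real defective_markov"
  have A: "?A \<in> carrier_mat 3 3"
    by (simp add: defective_markov_carrier)
  have "\<not> diagonalizable_mat ?A"
  proof
    assume "diagonalizable_mat ?A"
    then obtain D where "similar_mat ?A D" "diagonal_mat D"
      by (auto simp: diagonalizable_mat_def)
    from similar_diagonal_matE[OF A this]
    obtain P Q where carr: "P \<in> carrier_mat 3 3" "Q \<in> carrier_mat 3 3" and PQ: "P * Q = 1\<^sub>m 3"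
      and eig: "\<And>i j. i < 3 \<Longrightarrow> j < 3 \<Longrightarrow>
        (\<Sum>k<3. ?A $$ (i, k) * P $$ (k, j)) = D $$ (j, j) * P $$ (i, j)"
      by blast
    have last_row: "P $$ (2, j) = 0" if j: "j < 3" for j
    proof (rule ccontr)
      assume nz: "P $$ (2, j) \<noteq> 0"
      \<comment> \<open>Indices start at 0, so row 2 is the last row of the matrix. Its only nonzero
        entry is the diagonal 1/2, which forces the eigenvalue to be 1/2 once
        \<open>P $$ (2, j)\<close> is nonzero.\<close>
      have "P $$ (2, j) / 2 = D $$ (j, j) * P $$ (2, j)"
        using eig[of 2 j] j
        by (simp add: defective_markov_def mat_of_rows_list_def numeral_3_eq_3 numeral_2_eq_2)
      with nz have half: "D $$ (j, j) = 1 / 2"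
        by (simp add: field_simps)
      \<comment> \<open>In the middle row, the eigenvalue 1/2 cancels the diagonal term, and only
        the contribution of the off-diagonal 1/2 remains.\<close>
      have "P $$ (1, j) / 2 + P $$ (2, j) / 2 = D $$ (j, j) * P $$ (1, j)"
        using eig[of 1 j] j
        by (simp add: defective_markov_def mat_of_rows_list_def numeral_3_eq_3 numeral_2_eq_2)
      then have "P $$ (2, j) / 2 = 0"
        unfolding half by (simp only: times_divide_eq_left mult_1 add_cancel_left_right)
      with nz show False
        by simp
    qed
    \<comment> \<open>A zero last row of \<open>P\<close> makes the last row of \<open>P * Q\<close>
      zero, whereas the identity matrix has 1 at position (2, 2).\<close>
    have "(P * Q) $$ (2, 2) = (\<Sum>k<3. P $$ (2, k) * Q $$ (k, 2))"
      using carr by (simp add: scalar_prod_def atLeast0LessThan)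
    also have "\<dots> = 0"
      by (simp add: last_row)
    finally show False
      by (simp add: PQ)
  qed
  then show ?thesis
    using defective_markov_carrier by (simp add: defective_mat_def)
qed

theorem mainTheorem6:
  shows "\<exists>(n::nat) (A::real mat). markov_mat n A \<and> defective_mat A"
  using markov_defective_markov defective_mat_defective_markov by blast

end
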